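(* Let $(A,\phi)$ be a $\mathbf C$-valued noncommutative probability space and let $a\in A$ with $\phi(a)\ne0$. Let $T=\sum_{k\ge0}\alpha_kz^k\in\mathbf C[[z]]$ be the T-transform of the moment generating function $\Phi_a(z)=\sum_{n\ge0}\phi(a^{n+1})z^n$ of $a$. Then for every positive integer $n$, $$\phi(a^n)=\sum_{\pi\in\mathrm{NCL}(n)}\alpha_0^{\,n-|\pi|}\prod_{S\in\pi}\alpha_{|S|-1}.$$
   Context: A $\mathbf C$-valued noncommutative probability space is a pair $(A,\phi)$ with $A$ a unital complex algebra and $\phi:A\to\mathbf C$ a linear functional with $\phi(1)=1$. For a formal power series $F\in\mathbf C[[z]]$ with $F(0)\ne0$, the T-transform of $F$ is the formal power series $T_F(z)=F(G(z))\,(1+z)^{-1}$, where $G$ is the inverse with respect to composition of the series $zF(z)$; equivalently $T_F$ is the unique formal power series satisfying $T_F(zF(z))\,(1+zF(z))=F(z)$. For $E,F\subseteq\{1,\ldots,n\}$: $E$ and $F$ are crossing if there exist $i_1,i_2\in E$ and $j_1,j_2\in F$ with $i_1<j_1<i_2<j_2$; for distinct blocks, "noncrossing" means that no such pattern occurs, with the roles of $E$ and $F$ taken in either order. $E$ and $F$ are nearly disjoint if for every $i\in E\cap F$ one of the following holds: (a) $i=\min(E)$, $|E|>1$ and $i\ne\min(F)$; (b) $i\ne\min(E)$, $i=\min(F)$ and $|F|>1$. A set $\pi$ of nonempty subsets of $\{1,\ldots,n\}$ is a noncrossing linked partition of $\{1,\ldots,n\}$ if the union of $\pi$ is all of $\{1,\ldots,n\}$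 and any two distinct elements of $\pi$ are noncrossing and nearly disjoint. $\mathrm{NCL}(n)$ is the set of all noncrossing linked partitions of $\{1,\ldots,n\}$; elements $S\in\pi$ are called blocks and $|\pi|$ is the number of blocks. *)

theory Defs
  imports Complex_Main "HOL-Computational_Algebra.Formal_Power_Series"
begin

locale complex_algebra = vector_space scale
  for scale :: "complex \<Rightarrow> 'a::ring_1 \<Rightarrow> 'a" +
  assumes scale_mult_left: "scale c x * y = scale c (x * y)"
    and scale_mult_right: "x * scale c y = scale c (x * y)"

(* The class constraint ring_1 includes 0 \<noteq> 1; this is no restriction, since a linear
   functional with phi 1 = 1 does not exist on the zero algebra. *)
locale nc_prob_space = complex_algebra scale
  for scale :: "complex \<Rightarrow> 'a::ring_1 \<Rightarrow> 'a" +
  fixes phi :: "'a \<Rightarrow> complex"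
  assumes linear_phi: "Vector_Spaces.linear scale (*) phi"
    and phi_one: "phi 1 = 1"

definition moment_gf :: "('a::ring_1 \<Rightarrow> complex) \<Rightarrow> 'a \<Rightarrow> complex fps" where
  "moment_gf phi a = Abs_fps (\<lambda>n. phi (a ^ (n + 1)))"

(* fps_inv is the inverse for composition, inverse the multiplicative inverse.
   Meaningful only if the constant coefficient of F is nonzero. *)
definition T_transform :: "complex fps \<Rightarrow> complex fps" where
  "T_transform F = (F oo fps_inv (fps_X * F)) * inverse (1 + fps_X)"

definition crossing :: "nat set \<Rightarrow> nat set \<Rightarrow> bool" where
  "crossing E F \<longleftrightarrow>
     (\<exists>i1\<in>E. \<exists>i2\<in>E. \<exists>j1\<in>F. \<exists>j2\<in>F. i1 < j1 \<and> j1 < i2 \<and> i2 < j2)"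

definition noncrossing :: "nat set \<Rightarrow> nat set \<Rightarrow> bool" where
  "noncrossing E F \<longleftrightarrow> \<not> crossing E F \<and> \<not> crossing F E"

definition nearly_disjoint :: "nat set \<Rightarrow> nat set \<Rightarrow> bool" where
  "nearly_disjoint E F \<longleftrightarrow>
     (\<forall>i\<in>E \<inter> F. (i = Min E \<and> card E > 1 \<and> i \<noteq> Min F) \<or>
                  (i \<noteq> Min E \<and> i = Min F \<and> card F > 1))"

definition NCL :: "nat \<Rightarrow> nat set set set" where
  "NCL n = {\<pi>. (\<forall>S\<in>\<pi>. S \<noteq> {} \<and> S \<subseteq> {1..n}) \<and> \<Union>\<pi> = {1..n} \<and>
     (\<forall>E\<in>\<pi>. \<forall>F\<in>\<pi>. E \<noteq> F \<longrightarrow> noncrossing E F \<and> nearly_disjoint E F)}"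

end

theory Submission
  imports Defs
begin

text \<open>
  Write \<open>M(z) = z F(z) = \<Sum>\<^sub>n\<^sub>\<ge>\<^sub>1 \<phi>(a\<^sup>n) z\<^sup>n\<close>. The definition of the T-transform turns into the functional
  equation \<open>M = z (1 + M) T(M)\<close>, that is \<open>M = \<Sum>\<^sub>k \<alpha>\<^sub>k z (1 + M) M\<^sup>k\<close>, which determines \<open>M\<close> recursively
  (\<open>T_transform_functional_equation\<close>). The claim holds because noncrossing linked partitions have the same
  recursive structure. The point \<open>1\<close> lies in exactly one block \<open>{1 = s\<^sub>0 < s\<^sub>1 < \<dots> < s\<^sub>k}\<close>, which
  contributes \<open>\<alpha>\<^sub>k\<close>; the other blocks cannot cross it and can meet it only in their own minimum, so each of
  them lives in one of the intervals
  \<open>(s\<^sub>0, s\<^sub>1)\<close>, \<open>[s\<^sub>1, s\<^sub>2)\<close>, \<dots>, \<open>[s\<^sub>k, n]\<close>. The first interval may be empty and gives the factor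
  \<open>1 + M\<close>, the \<open>k\<close> others are nonempty and give \<open>M\<close> each. Their left end points are included because \<open>s\<^sub>i\<close>
  may be the minimum of a second block.

  The point \<open>s\<^sub>i\<close> may equally well be in no second block, while a linked partition of \<open>[s\<^sub>i, s\<^sub>i\<^sub>+\<^sub>1)\<close> has to
  cover it, by a singleton if necessary. Such singletons would have to be inserted and removed all the
  time. They disappear after a renormalisation: \<open>\<alpha>\<^sub>0 = \<phi>(a) \<noteq> 0\<close>, so with \<open>\<beta>\<^sub>k = \<alpha>\<^sub>k / \<alpha>\<^sub>0\<close> the summand is
  \<open>\<alpha>\<^sub>0\<^sup>n \<Prod>\<^sub>S \<beta>\<^sub>|\<^sub>S\<^sub>|\<^sub>-\<^sub>1\<close>, where singletons have weight \<open>\<beta>\<^sub>0 = 1\<close>. A linked partition is determined by its blocks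
  with at least two elements, here called its skeleton, since the singletons are exactly the points
  that remain uncovered. So the sum may run over skeletons (\<open>sum_NCL_eq_sum_skeletons\<close>).

  For skeletons on an interval \<open>[a, b)\<close> the decomposition is carried out in two binary steps: split by the
  block of \<open>a\<close> (\<open>sum_skeletons_eq_sum_rooted\<close>), then cut off the largest element \<open>m\<close> of this block together
  with everything that lives in \<open>[m, b)\<close> (\<open>sum_rooted_skeletons_Suc\<close>). Iterating the second step produces
  the coefficients of \<open>z (1 + M) M\<^sup>k\<close>, and induction on \<open>b - a\<close> concludes (\<open>sum_skeletons_eq_coeff\<close>).
  Treating all intervals at once makes it unnecessary to translate the pieces back to \<open>{1..n}\<close>.
\<close>

section \<open>Skeletons\<close>

text \<open>For blocks with at least two elements, being nearly disjoint means that a common element is the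
  minimum of exactly one of the two.\<close>
definition compatible :: "nat set \<Rightarrow> nat set \<Rightarrow> bool" where
  "compatible E F \<longleftrightarrow> noncrossing E F \<and> (\<forall>i\<in>E \<inter> F. (i = Min E) \<noteq> (i = Min F))"

text \<open>The possible sets of non-singleton blocks of linked partitions of \<open>A\<close>. Points of \<open>A\<close> may stay
  uncovered.\<close>
definition skeletons :: "nat set \<Rightarrow> nat set set set" where
  "skeletons A = {\<rho>. (\<forall>S\<in>\<rho>. S \<subseteq> A \<and> 2 \<le> card S) \<and>
     (\<forall>E\<in>\<rho>. \<forall>F\<in>\<rho>. E \<noteq> F \<longrightarrow> compatible E F)}"

text \<open>A skeleton on \<open>{a..<b}\<close> in which the block \<open>S\<close> of \<open>a\<close> has been singled out; \<open>\<rho>\<close> consists of the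
  remaining blocks. If no block contains \<open>a\<close>, then \<open>S = {a}\<close>, so the case \<open>k = 0\<close> stands for an uncovered left
  end point. Since \<open>Min S = a\<close> lies in no other block, a point that \<open>S\<close> shares with \<open>F \<in> \<rho>\<close> has to be the
  minimum of \<open>F\<close>.\<close>
definition rooted_skeletons :: "nat \<Rightarrow> nat \<Rightarrow> nat \<Rightarrow> (nat set \<times> nat set set) set" where
  "rooted_skeletons a b k = {(S, \<rho>). a \<in> S \<and> S \<subseteq> {a..<b} \<and> card S = Suc k \<and>
     \<rho> \<in> skeletons {Suc a..<b} \<and>
     (\<forall>F\<in>\<rho>. noncrossing S F \<and> (\<forall>i\<in>S \<inter> F. i = Min F))}"

definition weight :: "(nat \<Rightarrow> complex) \<Rightarrow> nat set set \<Rightarrow> complex" where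
  "weight \<beta> \<rho> = (\<Prod>S\<in>\<rho>. \<beta> (card S - 1))"

lemma noncrossing_sym: "noncrossing E F \<longleftrightarrow> noncrossing F E"
  by (auto simp: noncrossing_def)

lemma compatible_sym: "compatible E F \<longleftrightarrow> compatible F E"
  by (auto simp: compatible_def noncrossing_sym[of E F])

lemma noncrossing_singleton: "noncrossing {x} F" "noncrossing F {x}"
  unfolding noncrossing_def crossing_def by (metis less_asym less_trans singletonD)+

text \<open>In either order, a crossing needs a point of \<open>F\<close> strictly to the left of a point of \<open>E\<close>.\<close>
lemma noncrossing_if_separated:
  assumes "\<forall>x\<in>E. x \<le> m" "\<forall>y\<in>F. m \<le> y"
  shows "noncrossing E F"
  using assms unfolding noncrossing_def crossing_def by (meson leD le_trans)

lemma skeletonD: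
  assumes "\<rho> \<in> skeletons A" "S \<in> \<rho>"
  shows "S \<subseteq> A" "2 \<le> card S"
  using assms by (auto simp: skeletons_def)

lemma finite_skeletons: "finite A \<Longrightarrow> finite (skeletons A)"
  by (rule finite_subset[of _ "Pow (Pow A)"]) (auto simp: skeletons_def)

lemma finite_skeleton: "\<lbrakk>finite A; \<rho> \<in> skeletons A\<rbrakk> \<Longrightarrow> finite \<rho>"
  by (rule finite_subset[of _ "Pow A"]) (auto simp: skeletons_def)

lemma finite_rooted_skeletons: "finite (rooted_skeletons a b k)"
  by (rule finite_subset[of _ "Pow {a..<b} \<times> skeletons {Suc a..<b}"])
     (auto simp: rooted_skeletons_def finite_skeletons)

lemma skeletons_mono: "A \<subseteq> B \<Longrightarrow> skeletons A \<subseteq> skeletons B"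
  by (auto simp: skeletons_def)

lemma skeletons_subset: "\<lbrakk>\<rho> \<in> skeletons A; \<sigma> \<subseteq> \<rho>; \<And>S. S \<in> \<sigma> \<Longrightarrow> S \<subseteq> B\<rbrakk> \<Longrightarrow> \<sigma> \<in> skeletons B"
  unfolding skeletons_def mem_Collect_eq by (meson subsetD)

lemma skeletons_Un:
  assumes "\<rho> \<in> skeletons A" "\<sigma> \<in> skeletons A"
    and "\<And>E F. \<lbrakk>E \<in> \<rho>; F \<in> \<sigma>\<rbrakk> \<Longrightarrow> compatible E F"
  shows "\<rho> \<union> \<sigma> \<in> skeletons A"
  unfolding skeletons_def mem_Collect_eq
proof (intro conjI ballI impI)
  fix S assume "S \<in> \<rho> \<union> \<sigma>"
  then show "S \<subseteq> A" "2 \<le> card S" using skeletonD assms by auto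
next
  fix E F assume EF: "E \<in> \<rho> \<union> \<sigma>" "F \<in> \<rho> \<union> \<sigma>" "E \<noteq> F"
  then consider "E \<in> \<rho>" "F \<in> \<rho>" | "E \<in> \<sigma>" "F \<in> \<sigma>" | "E \<in> \<rho>" "F \<in> \<sigma>" | "E \<in> \<sigma>" "F \<in> \<rho>" by blast
  then show "compatible E F"
  proof cases
    case 4
    then show ?thesis using assms(3) compatible_sym by blast
  qed (use assms EF(3) in \<open>auto simp: skeletons_def\<close>)
qed

lemma skeletons_empty: "skeletons {} = {{}}"
  by (auto simp: skeletons_def)

section \<open>Removing the singletons of a linked partition\<close>

lemma nearly_disjoint_iff_compatible:
  assumes "2 \<le> card E" "2 \<le> card F"
  shows "noncrossing E F \<and> nearly_disjoint E F \<longleftrightarrow> compatible E F"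
  using assms unfolding nearly_disjoint_def compatible_def by auto

text \<open>A common element has to be the minimum of one of the two sets without being the only element of
  that set, and not the minimum of the other. A singleton offers no such element.\<close>
lemma singleton_nearly_disjoint: "nearly_disjoint {x} F \<longleftrightarrow> x \<notin> F"
  by (auto simp: nearly_disjoint_def)

lemma NCL_blockD:
  assumes "\<pi> \<in> NCL n" "S \<in> \<pi>"
  shows "S \<noteq> {}" "S \<subseteq> {1..n}"
  using assms by (auto simp: NCL_def)

lemma NCL_pairD:
  assumes "\<pi> \<in> NCL n" "E \<in> \<pi>" "F \<in> \<pi>" "E \<noteq> F"
  shows "noncrossing E F" "nearly_disjoint E F"
  using assms by (auto simp: NCL_def)

text \<open>Dropping the singletons is a bijection onto skeletons, inverted by adding \<open>{x}\<close> for every uncovered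
  point \<open>x\<close>: by near disjointness a singleton block meets no other block, so its point is indeed uncovered
  once it is dropped. Weights agree because singletons have weight \<open>\<beta> 0\<close>.\<close>
lemma sum_NCL_eq_sum_skeletons:
  assumes "\<beta> 0 = 1"
  shows "(\<Sum>\<pi>\<in>NCL n. weight \<beta> \<pi>) = (\<Sum>\<rho>\<in>skeletons {1..n}. weight \<beta> \<rho>)"
proof -
  let ?j = "\<lambda>\<pi>. {S\<in>\<pi>. 2 \<le> card S}"
  let ?i = "\<lambda>\<rho>. \<rho> \<union> (\<lambda>x. {x}) ` ({1..n} - \<Union>\<rho>)"
  have small: "\<exists>x\<in>{1..n}. S = {x}" if "\<pi> \<in> NCL n" "S \<in> \<pi>" "\<not> 2 \<le> card S" for \<pi> S
  proof -
    note S = NCL_blockD[OF that(1,2)]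
    then have "card S = 1" using that(3)
      using card_0_eq[OF finite_subset[OF S(2)]] S(1) that(3) by simp
    then show ?thesis using S by (auto simp: card_1_singleton_iff)
  qed
  show ?thesis
  proof (rule sum.reindex_bij_witness[where i = ?i and j = ?j])
    fix \<pi> assume \<pi>: "\<pi> \<in> NCL n"
    have fin: "finite \<pi>"
      by (rule finite_subset[of _ "Pow {1..n}"]) (use \<pi> in \<open>auto simp: NCL_def\<close>)
    have alone: "S = {x}" if "{x} \<in> \<pi>" "S \<in> \<pi>" "x \<in> S" for x S
    proof (rule ccontr)
      assume "S \<noteq> {x}"
      then have "nearly_disjoint {x} S" using NCL_pairD(2)[OF \<pi> that(1,2)] by simp
      then show False using that(3) by (simp add: singleton_nearly_disjoint)
    qed
    have un: "\<Union>\<pi> = {1..n}" using \<pi> by (auto simp: NCL_def)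
    show "?i (?j \<pi>) = \<pi>"
    proof (intro equalityI subsetI)
      fix S assume "S \<in> ?i (?j \<pi>)"
      then consider "S \<in> \<pi>" | x where "S = {x}" "x \<in> {1..n}" "x \<notin> \<Union>(?j \<pi>)" by blast
      then show "S \<in> \<pi>"
      proof cases
        case 2
        then obtain F where F: "F \<in> \<pi>" "x \<in> F" using un by blast
        then have "\<not> 2 \<le> card F" using 2 by blast
        then show ?thesis using small[OF \<pi> F(1)] F 2 by auto
      qed
    next
      fix S assume S: "S \<in> \<pi>"
      show "S \<in> ?i (?j \<pi>)"
      proof (cases "2 \<le> card S")
        case False
        then obtain x where x: "x \<in> {1..n}" "S = {x}" using small[OF \<pi> S] by auto
        have "x \<notin> F" if "F \<in> ?j \<pi>" for F
        proof
          assume "x \<in> F"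
          then have "F = {x}" using alone[of x F] S x(2) that by simp
          then show False using that by simp
        qed
        then show ?thesis using x by blast
      qed (use S in auto)
    qed
    show "?j \<pi> \<in> skeletons {1..n}"
      using NCL_blockD[OF \<pi>] NCL_pairD[OF \<pi>]
      by (auto simp: skeletons_def nearly_disjoint_iff_compatible[symmetric])
    have "\<beta> (card S - 1) = 1" if "S \<in> \<pi> - ?j \<pi>" for S
      using small[OF \<pi>, of S] that assms by auto
    then show "weight \<beta> (?j \<pi>) = weight \<beta> \<pi>"
      unfolding weight_def by (intro prod.mono_neutral_left fin) auto
  next
    fix \<rho> assume \<rho>: "\<rho> \<in> skeletons {1..n}"
    show "?j (?i \<rho>) = \<rho>" using skeletonD[OF \<rho>] by auto
    have ne: "S \<noteq> {}" if "S \<in> \<rho>" for S using skeletonD[OF \<rho> that] by auto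
    have nd: "noncrossing E F \<and> nearly_disjoint E F"
      if "E \<in> ?i \<rho>" "F \<in> ?i \<rho>" "E \<noteq> F" for E F
    proof (cases "E \<in> \<rho> \<and> F \<in> \<rho>")
      case True
      then have "compatible E F" using \<rho> that by (auto simp: skeletons_def)
      then show ?thesis using nearly_disjoint_iff_compatible skeletonD(2)[OF \<rho>] True by blast
    next
      case False
      then have "E \<inter> F = {}" using that by blast
      moreover have "noncrossing E F" using False that noncrossing_singleton by blast
      ultimately show ?thesis by (simp add: nearly_disjoint_def)
    qed
    show "?i \<rho> \<in> NCL n"
      unfolding NCL_def mem_Collect_eq
    proof (intro conjI ballI impI)
      fix S assume "S \<in> ?i \<rho>"
      then show "S \<noteq> {}" "S \<subseteq> {1..n}" using skeletonD(1)[OF \<rho>] ne by auto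
    next
      show "\<Union>(?i \<rho>) = {1..n}" using skeletonD(1)[OF \<rho>] by auto
    qed (use nd in blast)+
  qed
qed

text \<open>Near disjointness forces distinct blocks to have distinct minima.\<close>
lemma card_NCL_le:
  assumes "\<pi> \<in> NCL n"
  shows "card \<pi> \<le> n"
proof -
  have S: "S \<noteq> {}" "S \<subseteq> {1..n}" "finite S" if "S \<in> \<pi>" for S
    using NCL_blockD[OF assms that] finite_subset by auto
  have "inj_on Min \<pi>"
  proof (rule inj_onI, rule ccontr)
    fix E F assume EF: "E \<in> \<pi>" "F \<in> \<pi>" "Min E = Min F" "E \<noteq> F"
    then have "nearly_disjoint E F" using NCL_pairD(2)[OF assms] by simp
    moreover have "Min E \<in> E \<inter> F" using EF S Min_in by (metis IntI)
    ultimately show False using EF(3) by (auto simp: nearly_disjoint_def)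
  qed
  moreover have "Min ` \<pi> \<subseteq> {1..n}" using S Min_in by blast
  ultimately show ?thesis using card_inj_on_le[of Min \<pi> "{1..n}"] by simp
qed

section \<open>Decomposing skeletons\<close>

lemma subset_Suc_interval:
  fixes S :: "nat set"
  assumes "S \<subseteq> {a..<b}" "a \<notin> S"
  shows "S \<subseteq> {Suc a..<b}"
proof
  fix x assume "x \<in> S"
  then have "x \<in> {a..<b}" "x \<noteq> a" using assms by auto
  then show "x \<in> {Suc a..<b}" by auto
qed

lemma rooted_skeletons_0:
  assumes "a < b"
  shows "rooted_skeletons a b 0 = {{a}} \<times> skeletons {Suc a..<b}"
proof -
  have "a \<notin> F" if "\<rho> \<in> skeletons {Suc a..<b}" "F \<in> \<rho>" for \<rho> F
    using skeletonD(1)[OF that] by auto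
  then show ?thesis
    using assms noncrossing_singleton by (auto simp: rooted_skeletons_def card_1_singleton_iff)
qed

text \<open>Two blocks containing the left end point \<open>a\<close> would both have minimum \<open>a\<close>, which compatibility
  excludes. Hence there is at most one, and singling it out is a bijection. If there is none, the fictitious
  block \<open>{a}\<close> contributes the factor \<open>\<beta> 0 = 1\<close>.\<close>
lemma sum_skeletons_eq_sum_rooted:
  assumes "a < b" "\<beta> 0 = 1"
  shows "(\<Sum>\<rho>\<in>skeletons {a..<b}. weight \<beta> \<rho>) =
    (\<Sum>k<b - a. \<beta> k * (\<Sum>(S, \<rho>)\<in>rooted_skeletons a b k. weight \<beta> \<rho>))"
proof -
  \<comment> \<open>At most one block contains \<open>a\<close>, so this union is the block of \<open>a\<close> if there is one and \<open>{a}\<close> otherwise.\<close>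
  let ?root = "\<lambda>\<rho>. insert a (\<Union>{S\<in>\<rho>. a \<in> S})"
  let ?j = "\<lambda>\<rho>. (card (?root \<rho>) - 1, ?root \<rho>, \<rho> - {?root \<rho>})"
  let ?i = "\<lambda>(k::nat, S, \<rho>). if k = 0 then \<rho> else insert S \<rho>"
  have "(\<Sum>\<rho>\<in>skeletons {a..<b}. weight \<beta> \<rho>) =
    (\<Sum>(k, S, \<rho>)\<in>Sigma {..<b - a} (rooted_skeletons a b). \<beta> k * weight \<beta> \<rho>)"
  proof (rule sum.reindex_bij_witness[where i = ?i and j = ?j])
    fix \<rho> assume \<rho>: "\<rho> \<in> skeletons {a..<b}"
    have fin: "finite \<rho>" using \<rho> finite_skeleton by blast
    have min: "Min S = a" if "S \<in> \<rho>" "a \<in> S" for S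
      using skeletonD(1)[OF \<rho> that(1)] that(2)
      by (intro Min_eqI) (auto intro: finite_subset)
    have comp: "compatible E F" if "E \<in> \<rho>" "F \<in> \<rho>" "E \<noteq> F" for E F
      using \<rho> that by (auto simp: skeletons_def)
    have uniq: "E = F" if "E \<in> \<rho>" "F \<in> \<rho>" "a \<in> E" "a \<in> F" for E F
      using comp[OF that(1,2)] that min by (auto simp: compatible_def)
    consider (none) "\<forall>S\<in>\<rho>. a \<notin> S" "?root \<rho> = {a}" "\<rho> - {{a}} = \<rho>"
      | (block) S where "S \<in> \<rho>" "a \<in> S" "?root \<rho> = S"
    proof (cases "\<exists>S\<in>\<rho>. a \<in> S")
      case True
      then obtain S where S: "S \<in> \<rho>" "a \<in> S" by blast
      then have "{S\<in>\<rho>. a \<in> S} = {S}" using uniq by blast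
      then show thesis using S by (intro block[OF S]) auto
    next
      case False
      then have "{S\<in>\<rho>. a \<in> S} = {}" by blast
      then have root: "?root \<rho> = {a}" by (simp only: Union_empty)
      moreover have "\<rho> - {{a}} = \<rho>" using False by blast
      ultimately show thesis using False by (intro none) auto
    qed
    note cases = this
    show "?i (?j \<rho>) = \<rho>"
      using cases
    proof cases
      case (block S)
      then show ?thesis using skeletonD(2)[OF \<rho>, of S] by auto
    next
      case none
      show ?thesis unfolding none(2) using none(3) by simp
    qed
    show "?j \<rho> \<in> Sigma {..<b - a} (rooted_skeletons a b)"
      using cases
    proof cases
      case none
      have "\<rho> \<in> skeletons {Suc a..<b}"
      proof (rule skeletons_subset[OF \<rho> order_refl])
        fix S assume "S \<in> \<rho>"
        then have "S \<subseteq> {a..<b}" "a \<notin> S" using none(1) skeletonD(1)[OF \<rho>] by auto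
        then show "S \<subseteq> {Suc a..<b}" by (rule subset_Suc_interval)
      qed
      then show ?thesis unfolding none(2,3) using assms(1) by (simp add: rooted_skeletons_0)
    next
      case (block S)
      have S: "S \<subseteq> {a..<b}" "2 \<le> card S" using skeletonD[OF \<rho> block(1)] by auto
      have "card S \<le> b - a" using card_mono[OF _ S(1)] by simp
      moreover have "\<rho> - {S} \<in> skeletons {Suc a..<b}"
      proof (rule skeletons_subset[OF \<rho>])
        fix F assume F: "F \<in> \<rho> - {S}"
        then have "F \<subseteq> {a..<b}" "a \<notin> F" using uniq block skeletonD(1)[OF \<rho>] by auto
        then show "F \<subseteq> {Suc a..<b}" by (rule subset_Suc_interval)
      qed auto
      moreover have "noncrossing S F \<and> (\<forall>i\<in>S \<inter> F. i = Min F)" if F: "F \<in> \<rho> - {S}" for F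
      proof -
        have "compatible S F" "a \<notin> F" using F comp[OF block(1), of F] uniq[OF block(1), of F] block(2) by auto
        then show ?thesis using min[OF block(1,2)] unfolding compatible_def by (metis IntD2)
      qed
      ultimately show ?thesis
        unfolding block(3) using S block(2) by (auto simp: rooted_skeletons_def)
    qed
    show "(case ?j \<rho> of (k, S, \<rho>) \<Rightarrow> \<beta> k * weight \<beta> \<rho>) = weight \<beta> \<rho>"
      using cases
    proof cases
      case none
      show ?thesis unfolding none(2,3) using assms(2) by simp
    next
      case (block S)
      show ?thesis unfolding block(3) using prod.remove[OF fin block(1), of "\<lambda>S. \<beta> (card S - 1)"]
        by (simp add: weight_def)
    qed
  next
    fix t assume t: "t \<in> Sigma {..<b - a} (rooted_skeletons a b)"
    obtain k S \<rho> where t_eq: "t = (k, S, \<rho>)" by (cases t)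
    have S: "a \<in> S" "S \<subseteq> {a..<b}" "card S = Suc k" and \<rho>: "\<rho> \<in> skeletons {Suc a..<b}"
      and on: "\<And>F. F \<in> \<rho> \<Longrightarrow> noncrossing S F \<and> (\<forall>i\<in>S \<inter> F. i = Min F)"
      using t by (auto simp: t_eq rooted_skeletons_def)
    have a: "a \<notin> F" if "F \<in> \<rho>" for F using skeletonD(1)[OF \<rho> that] by auto
    have S0: "S = {a}" if "k = 0" using S that by (auto simp: card_1_singleton_iff)
    have "S \<notin> \<rho>" using a S by blast
    have none: "{F\<in>\<rho>. a \<in> F} = {}" using a by blast
    have root: "?root (?i t) = S"
      using none S(1) S0 by (cases "k = 0") (auto simp: t_eq dest: a)
    show "?j (?i t) = t"
      unfolding root using S \<open>S \<notin> \<rho>\<close> by (auto simp: t_eq)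
    have minS: "Min S = a"
      using S by (intro Min_eqI) (auto intro: finite_subset)
    have comp: "compatible S F" if "F \<in> \<rho>" for F
      using on[OF that] a[OF that] minS by (auto simp: compatible_def)
    have "\<rho> \<in> skeletons {a..<b}" using skeletons_mono[of "{Suc a..<b}" "{a..<b}"] \<rho> by auto
    moreover have "{S} \<in> skeletons {a..<b}" if "k \<noteq> 0" using that S by (simp add: skeletons_def)
    ultimately show "?i t \<in> skeletons {a..<b}"
      using skeletons_Un[of "{S}" "{a..<b}" \<rho>] comp by (auto simp: t_eq)
  qed
  also have "\<dots> = (\<Sum>k<b - a. \<Sum>(S, \<rho>)\<in>rooted_skeletons a b k. \<beta> k * weight \<beta> \<rho>)"
    by (subst sum.Sigma) (auto simp: finite_rooted_skeletons)
  finally show ?thesis by (simp add: sum_distrib_left case_prod_unfold)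
qed

text \<open>Let \<open>m\<close> be the largest element of the block \<open>S\<close> of \<open>a\<close>. Another block with a point in \<open>(a, m)\<close> and
  one beyond \<open>m\<close> would cross \<open>S\<close>, and one with a point in \<open>(a, m)\<close> that contains \<open>m\<close> would meet \<open>S\<close> in a point
  other than its minimum. So every other block lies on one side of \<open>m\<close>. Those on the left together with
  \<open>S - {m}\<close> form a rooted skeleton on \<open>{a..<m}\<close>, and those on the right form an arbitrary skeleton on \<open>{m..<b}\<close>,
  where \<open>m\<close> itself may be the minimum of a block.\<close>
lemma sum_rooted_skeletons_Suc:
  "(\<Sum>(S, \<rho>)\<in>rooted_skeletons a b (Suc k). weight \<beta> \<rho>) =
    (\<Sum>m\<in>{Suc a..<b}. (\<Sum>(S, \<rho>)\<in>rooted_skeletons a m k. weight \<beta> \<rho>) *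
       (\<Sum>\<rho>\<in>skeletons {m..<b}. weight \<beta> \<rho>))"
proof -
  let ?j = "\<lambda>(S, \<rho>). (Max S, (S - {Max S}, {F\<in>\<rho>. F \<subseteq> {..<Max S}}), {F\<in>\<rho>. F \<subseteq> {Max S..}})"
  let ?i = "\<lambda>(m, (S, \<rho>\<^sub>1), \<rho>\<^sub>2). (insert m S, \<rho>\<^sub>1 \<union> \<rho>\<^sub>2)"
  let ?T = "Sigma {Suc a..<b} (\<lambda>m. rooted_skeletons a m k \<times> skeletons {m..<b})"
  have "(\<Sum>(S, \<rho>)\<in>rooted_skeletons a b (Suc k). weight \<beta> \<rho>) =
    (\<Sum>(m, (S, \<rho>\<^sub>1), \<rho>\<^sub>2)\<in>?T. weight \<beta> \<rho>\<^sub>1 * weight \<beta> \<rho>\<^sub>2)"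
  proof (rule sum.reindex_bij_witness[where i = ?i and j = ?j])
    fix s assume s: "s \<in> rooted_skeletons a b (Suc k)"
    obtain S \<rho> where s_eq: "s = (S, \<rho>)" by (cases s)
    have S: "a \<in> S" "S \<subseteq> {a..<b}" "card S = Suc (Suc k)"
      and \<rho>: "\<rho> \<in> skeletons {Suc a..<b}"
      and on: "\<And>F. F \<in> \<rho> \<Longrightarrow> noncrossing S F \<and> (\<forall>i\<in>S \<inter> F. i = Min F)"
      using s by (auto simp: s_eq rooted_skeletons_def)
    have finS: "finite S" using S(2) finite_subset by blast
    define m where "m = Max S"
    have m: "m \<in> S" "\<And>x. x \<in> S \<Longrightarrow> x \<le> m"
      using Max_in[OF finS] Max_ge[OF finS] S(1) by (auto simp: m_def)
    have "a \<noteq> m"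
    proof
      assume "a = m"
      then have "S = {a}" using S(1,2) m(2) by force
      then show False using S(3) by simp
    qed
    then have am: "a < m" "m < b" using m S by force+
    have finF: "finite F" if "F \<in> \<rho>" for F
      using skeletonD(1)[OF \<rho> that] finite_subset by blast
    have split: "F \<subseteq> {..<m} \<or> F \<subseteq> {m..}" if F: "F \<in> \<rho>" for F
    proof (rule ccontr)
      assume "\<not> ?thesis"
      then obtain x y where xy: "x \<in> F" "x < m" "y \<in> F" "m \<le> y" by (auto simp: subset_iff not_less not_le)
      have "a < x" using skeletonD(1)[OF \<rho> F] xy by auto
      show False
      proof (cases "y = m")
        case True
        then have "m = Min F" using on[OF F] xy m by blast
        then show False using Min_le[OF finF[OF F] xy(1)] xy by simp
      next
        case False
        then have "m < y" using xy(4) by simp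
        then have "crossing S F" unfolding crossing_def using S(1) m(1) xy \<open>a < x\<close> by blast
        then show False using on[OF F] by (simp add: noncrossing_def)
      qed
    qed
    then have un: "{F\<in>\<rho>. F \<subseteq> {..<m}} \<union> {F\<in>\<rho>. F \<subseteq> {m..}} = \<rho>" by blast
    show "?i (?j s) = s"
      using un m(1) by (auto simp: s_eq m_def[symmetric])
    have 1: "{F\<in>\<rho>. F \<subseteq> {..<m}} \<in> skeletons {Suc a..<m}"
    proof (rule skeletons_subset[OF \<rho>])
      fix F assume "F \<in> {F\<in>\<rho>. F \<subseteq> {..<m}}"
      then show "F \<subseteq> {Suc a..<m}" using skeletonD(1)[OF \<rho>, of F] by fastforce
    qed auto
    have 2: "{F\<in>\<rho>. F \<subseteq> {m..}} \<in> skeletons {m..<b}"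
    proof (rule skeletons_subset[OF \<rho>])
      fix F assume "F \<in> {F\<in>\<rho>. F \<subseteq> {m..}}"
      then show "F \<subseteq> {m..<b}" using skeletonD(1)[OF \<rho>, of F] by fastforce
    qed auto
    have 3: "noncrossing (S - {m}) F" if "F \<in> \<rho>" for F
      using on[OF that] unfolding noncrossing_def crossing_def by blast
    have 4: "S - {m} \<subseteq> {a..<m}" using S(2) m(2) by force
    have "(S - {m}, {F\<in>\<rho>. F \<subseteq> {..<m}}) \<in> rooted_skeletons a m k"
      unfolding rooted_skeletons_def using S 1 3 4 on am m(1) finS by auto
    then show "?j s \<in> ?T" using 2 am by (simp add: s_eq m_def[symmetric])
    have "finite \<rho>" using \<rho> finite_skeleton by blast
    moreover have "{F\<in>\<rho>. F \<subseteq> {..<m}} \<inter> {F\<in>\<rho>. F \<subseteq> {m..}} = {}"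
    proof -
      have "F = {}" if "F \<subseteq> {..<m}" "F \<subseteq> {m..}" for F using that by fastforce
      moreover have "{} \<notin> \<rho>" using skeletonD(2)[OF \<rho>, of "{}"] by auto
      ultimately show ?thesis by blast
    qed
    ultimately have "weight \<beta> ({F\<in>\<rho>. F \<subseteq> {..<m}} \<union> {F\<in>\<rho>. F \<subseteq> {m..}}) =
        weight \<beta> {F\<in>\<rho>. F \<subseteq> {..<m}} * weight \<beta> {F\<in>\<rho>. F \<subseteq> {m..}}"
      unfolding weight_def by (intro prod.union_disjoint) auto
    then show "(\<lambda>(m, (S, \<rho>\<^sub>1), \<rho>\<^sub>2). weight \<beta> \<rho>\<^sub>1 * weight \<beta> \<rho>\<^sub>2) (?j s) =
        (case s of (S, \<rho>) \<Rightarrow> weight \<beta> \<rho>)"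
      unfolding un by (simp add: s_eq m_def[symmetric])
  next
    fix t assume t: "t \<in> ?T"
    obtain m S \<rho>\<^sub>1 \<rho>\<^sub>2 where t_eq: "t = (m, (S, \<rho>\<^sub>1), \<rho>\<^sub>2)" by (cases t) auto
    have m: "a < m" "m < b" and S: "a \<in> S" "S \<subseteq> {a..<m}" "card S = Suc k"
      and \<rho>\<^sub>1: "\<rho>\<^sub>1 \<in> skeletons {Suc a..<m}" and \<rho>\<^sub>2: "\<rho>\<^sub>2 \<in> skeletons {m..<b}"
      and on: "\<And>F. F \<in> \<rho>\<^sub>1 \<Longrightarrow> noncrossing S F \<and> (\<forall>i\<in>S \<inter> F. i = Min F)"
      using t by (auto simp: t_eq rooted_skeletons_def)
    have finS: "finite S" using S(2) finite_subset by blast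
    have "m \<notin> S" using S by auto
    have max: "Max (insert m S) = m"
      using S finS by (intro Max_eqI) auto
    have below: "F \<subseteq> {Suc a..<m}" "F \<noteq> {}" if "F \<in> \<rho>\<^sub>1" for F
      using skeletonD[OF \<rho>\<^sub>1 that] by auto
    have above: "F \<subseteq> {m..<b}" "F \<noteq> {}" if "F \<in> \<rho>\<^sub>2" for F
      using skeletonD[OF \<rho>\<^sub>2 that] by auto
    have low: "{F \<in> \<rho>\<^sub>1 \<union> \<rho>\<^sub>2. F \<subseteq> {..<m}} = \<rho>\<^sub>1"
    proof -
      have "F \<subseteq> {..<m}" if "F \<in> \<rho>\<^sub>1" for F using below[OF that] by auto
      moreover have "\<not> F \<subseteq> {..<m}" if "F \<in> \<rho>\<^sub>2" for F using above[OF that] by fastforce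
      ultimately show ?thesis by blast
    qed
    have high: "{F \<in> \<rho>\<^sub>1 \<union> \<rho>\<^sub>2. F \<subseteq> {m..}} = \<rho>\<^sub>2"
    proof -
      have "F \<subseteq> {m..}" if "F \<in> \<rho>\<^sub>2" for F using above[OF that] by auto
      moreover have "\<not> F \<subseteq> {m..}" if "F \<in> \<rho>\<^sub>1" for F using below[OF that] by fastforce
      ultimately show ?thesis by blast
    qed
    show "?j (?i t) = t"
      using \<open>m \<notin> S\<close> by (simp add: t_eq max low high del: Un_iff)
    have cross12: "compatible E F" if "E \<in> \<rho>\<^sub>1" "F \<in> \<rho>\<^sub>2" for E F
    proof -
      have "noncrossing E F" using below(1)[OF that(1)] above(1)[OF that(2)]
        by (intro noncrossing_if_separated[of _ m]) auto
      moreover have "E \<inter> F = {}" using below(1)[OF that(1)] above(1)[OF that(2)] by fastforce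
      ultimately show ?thesis by (simp add: compatible_def)
    qed
    have wide: "\<rho>\<^sub>1 \<in> skeletons {Suc a..<b}" "\<rho>\<^sub>2 \<in> skeletons {Suc a..<b}"
      using skeletons_mono[of "{Suc a..<m}" "{Suc a..<b}"] skeletons_mono[of "{m..<b}" "{Suc a..<b}"]
        \<rho>\<^sub>1 \<rho>\<^sub>2 m by auto
    have union: "\<rho>\<^sub>1 \<union> \<rho>\<^sub>2 \<in> skeletons {Suc a..<b}"
      using wide cross12 by (rule skeletons_Un)
    \<comment> \<open>A crossing of \<open>F\<close> with \<open>S\<close> extended by \<open>m\<close> already crosses \<open>S\<close>. In the pattern that starts in \<open>F\<close>, the
       last point may be \<open>m\<close>; replace it by \<open>a\<close>, which lies to the left of \<open>F\<close> and so comes first.\<close>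
    have on1: "noncrossing (insert m S) F \<and> (\<forall>i\<in>insert m S \<inter> F. i = Min F)" if F: "F \<in> \<rho>\<^sub>1" for F
    proof -
      have b: "\<And>x. x \<in> F \<Longrightarrow> a < x \<and> x < m" using below(1)[OF F] by fastforce
      have "\<not> crossing S F" using on[OF F] by (simp add: noncrossing_def)
      have "\<not> crossing (insert m S) F"
      proof
        assume "crossing (insert m S) F"
        then obtain i\<^sub>1 i\<^sub>2 j\<^sub>1 j\<^sub>2 where ij: "i\<^sub>1 \<in> insert m S" "i\<^sub>2 \<in> insert m S" "j\<^sub>1 \<in> F" "j\<^sub>2 \<in> F"
          "i\<^sub>1 < j\<^sub>1" "j\<^sub>1 < i\<^sub>2" "i\<^sub>2 < j\<^sub>2" unfolding crossing_def by blast
        then have "i\<^sub>1 \<in> S" "i\<^sub>2 \<in> S" using b[OF ij(4)] by auto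
        then show False using \<open>\<not> crossing S F\<close> ij unfolding crossing_def by blast
      qed
      moreover have "\<not> crossing F (insert m S)"
      proof
        assume "crossing F (insert m S)"
        then obtain i\<^sub>1 i\<^sub>2 j\<^sub>1 j\<^sub>2 where ij: "i\<^sub>1 \<in> F" "i\<^sub>2 \<in> F" "j\<^sub>1 \<in> insert m S" "j\<^sub>2 \<in> insert m S"
          "i\<^sub>1 < j\<^sub>1" "j\<^sub>1 < i\<^sub>2" "i\<^sub>2 < j\<^sub>2" unfolding crossing_def by blast
        then have "j\<^sub>1 \<in> S" "a < i\<^sub>1" using b[OF ij(1)] b[OF ij(2)] by auto
        then show False using \<open>\<not> crossing S F\<close> S(1) ij unfolding crossing_def by blast
      qed
      moreover have "i = Min F" if "i \<in> insert m S" "i \<in> F" for i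
        using that on[OF F] b[OF that(2)] by auto
      ultimately show ?thesis by (simp add: noncrossing_def)
    qed
    have on2: "noncrossing (insert m S) F \<and> (\<forall>i\<in>insert m S \<inter> F. i = Min F)" if F: "F \<in> \<rho>\<^sub>2" for F
    proof -
      have "noncrossing (insert m S) F" using above(1)[OF F] S(2)
        by (intro noncrossing_if_separated[of _ m]) auto
      moreover have "i = Min F" if "i \<in> insert m S" "i \<in> F" for i
      proof -
        have "i = m" using that S(2) above(1)[OF F] by fastforce
        then show ?thesis using that above(1)[OF F]
          by (intro Min_eqI[symmetric]) (auto intro: finite_subset)
      qed
      ultimately show ?thesis by blast
    qed
    have "card (insert m S) = Suc (Suc k)" using \<open>m \<notin> S\<close> finS S(3) by simp
    moreover have "insert m S \<subseteq> {a..<b}" using S(2) m by auto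
    ultimately show "?i t \<in> rooted_skeletons a b (Suc k)"
      unfolding rooted_skeletons_def using union on1 on2 S(1) by (auto simp: t_eq)
  qed
  also have "\<dots> = (\<Sum>m\<in>{Suc a..<b}. \<Sum>((S, \<rho>\<^sub>1), \<rho>\<^sub>2)\<in>rooted_skeletons a m k \<times> skeletons {m..<b}.
      weight \<beta> \<rho>\<^sub>1 * weight \<beta> \<rho>\<^sub>2)"
    by (subst sum.Sigma) (auto simp: finite_rooted_skeletons finite_skeletons)
  also have "\<dots> = (\<Sum>m\<in>{Suc a..<b}. (\<Sum>(S, \<rho>)\<in>rooted_skeletons a m k. weight \<beta> \<rho>) *
       (\<Sum>\<rho>\<in>skeletons {m..<b}. weight \<beta> \<rho>))"
    by (simp add: sum_product sum.cartesian_product case_prod_unfold)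
  finally show ?thesis .
qed

section \<open>The generating function\<close>

text \<open>Substitute \<open>M\<close> for the variable in the definition of the T-transform; this undoes the compositional
  inverse of \<open>M\<close> and leaves \<open>T(M) = F / (1 + M)\<close>.\<close>
lemma T_transform_functional_equation:
  assumes "fps_nth F 0 \<noteq> 0"
  defines "M \<equiv> fps_X * F"
  shows "M = fps_X * (1 + M) * (T_transform F oo M)"
proof -
  have M: "fps_nth M 0 = 0" "fps_nth M 1 \<noteq> 0" using assms by (simp_all add: M_def)
  have inv: "fps_inv M oo M = fps_X" using fps_inv[OF M] .
  have inv0: "fps_nth (fps_inv M) 0 = 0" by (simp add: fps_inv_def)
  have "T_transform F oo M = ((F oo fps_inv M) oo M) * (inverse (1 + fps_X) oo M)"
    unfolding T_transform_def M_def[symmetric] by (rule fps_compose_mult_distrib[OF M(1)])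
  also have "(F oo fps_inv M) oo M = F"
    using fps_compose_assoc[OF M(1) inv0, of F] inv by simp
  also have "inverse (1 + fps_X) oo M = inverse (1 + M)"
    using M(1) by (simp add: fps_inverse_compose fps_compose_add_distrib)
  finally have "fps_X * (1 + M) * (T_transform F oo M) = fps_X * F * ((1 + M) * inverse (1 + M))"
    by (simp add: mult_ac)
  also have "(1 + M) * inverse (1 + M) = 1"
    using M(1) by (simp add: inverse_mult_eq_1')
  finally show ?thesis by (simp add: M_def)
qed

lemma T_transform_nth_0: "fps_nth F 0 \<noteq> 0 \<Longrightarrow> fps_nth (T_transform F) 0 = fps_nth F 0"
  by (simp add: T_transform_def fps_inv_def)

text \<open>Only finitely many powers of \<open>M\<close> contribute to a coefficient, as \<open>M\<close> has no constant term. The factor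
  \<open>fps_X\<close> lowers the bound to \<open>k < n\<close>, matching the block sizes \<open>k + 1 \<le> n\<close> possible on an interval
  of length \<open>n\<close>.\<close>
lemma fps_mult_compose_nth:
  fixes A T M :: "complex fps"
  assumes "fps_nth M 0 = 0"
  shows "fps_nth (fps_X * A * (T oo M)) n = (\<Sum>k<n. fps_nth T k * fps_nth (fps_X * A * M ^ k) n)"
proof (cases n)
  case (Suc l)
  have z: "fps_nth (M ^ k) j = 0" if "j < k" for j k
    using startsby_zero_power_prefix[OF assms] that by simp
  have "fps_nth (T oo M) j = (\<Sum>k<n. fps_nth T k * fps_nth (M ^ k) j)" if "j < n" for j
    unfolding fps_compose_nth by (rule sum.mono_neutral_left) (use that z in auto)
  then have "fps_nth (A * (T oo M)) l =
      (\<Sum>i=0..l. \<Sum>k<n. fps_nth A i * (fps_nth T k * fps_nth (M ^ k) (l - i)))"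
    unfolding fps_mult_nth sum_distrib_left[symmetric] using Suc by (intro sum.cong refl) simp
  also have "\<dots> = (\<Sum>k<n. fps_nth T k * fps_nth (A * M ^ k) l)"
    by (subst sum.swap) (simp add: fps_mult_nth sum_distrib_left mult_ac)
  finally show ?thesis using Suc by (simp add: mult.assoc)
qed simp

text \<open>The functional equation and the two decomposition steps are the same recursion. The factor
  \<open>c ^ (b - a)\<close> undoes the normalisation \<open>\<beta> 0 = 1\<close>: interval lengths add up under the decomposition, and the
  step from \<open>\<beta>\<close> to \<open>T\<close> absorbs the one factor \<open>c\<close> left over for the point \<open>a\<close>.\<close>
lemma sum_skeletons_eq_coeff:
  fixes T M :: "complex fps"
  assumes M0: "fps_nth M 0 = 0" and M: "M = fps_X * (1 + M) * (T oo M)"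
    and c: "c = fps_nth T 0" "c \<noteq> 0"
  defines "\<beta> \<equiv> \<lambda>k. fps_nth T k / c"
  shows "a \<le> b \<Longrightarrow> c ^ (b - a) * (\<Sum>\<rho>\<in>skeletons {a..<b}. weight \<beta> \<rho>) = fps_nth (1 + M) (b - a)"
proof (induction "b - a" arbitrary: a b rule: less_induct)
  case less
  have \<beta>0: "\<beta> 0 = 1" using c by (simp add: \<beta>_def)
  show ?case
  proof (cases "a = b")
    case True
    then show ?thesis using M0 by (simp add: skeletons_empty weight_def)
  next
    case False
    then have ab: "a < b" using less.prems by simp
    \<comment> \<open>All left-hand pieces share the left end point \<open>a\<close>; every skeleton sum that occurs lives on an interval
       strictly shorter than \<open>{a..<b}\<close>, so the outer induction hypothesis applies to it.\<close>
    have G: "c ^ (d - a) * (\<Sum>(S, \<rho>)\<in>rooted_skeletons a d k. weight \<beta> \<rho>) =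
        c * fps_nth (fps_X * (1 + M) * M ^ k) (d - a)" if "a < d" "d \<le> b" for d k
      using that
    proof (induction k arbitrary: d)
      case 0
      have "c ^ (d - Suc a) * (\<Sum>\<rho>\<in>skeletons {Suc a..<d}. weight \<beta> \<rho>) = fps_nth (1 + M) (d - Suc a)"
        using less.hyps[of d "Suc a"] 0 by simp
      moreover have "d - a = Suc (d - Suc a)" using 0 by simp
      moreover have "(\<Sum>(S, \<rho>)\<in>rooted_skeletons a d 0. weight \<beta> \<rho>) =
          (\<Sum>\<rho>\<in>skeletons {Suc a..<d}. weight \<beta> \<rho>)"
        unfolding rooted_skeletons_0[OF 0(1)] by (simp add: sum.cartesian_product[symmetric])
      ultimately show ?case by (simp add: mult.assoc)
    next
      case (Suc k)
      let ?A = "fps_X * (1 + M) * M ^ k"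
      have "c ^ (d - a) * (\<Sum>(S, \<rho>)\<in>rooted_skeletons a d (Suc k). weight \<beta> \<rho>) =
        (\<Sum>m\<in>{Suc a..<d}. (c ^ (m - a) * (\<Sum>(S, \<rho>)\<in>rooted_skeletons a m k. weight \<beta> \<rho>)) *
           (c ^ (d - m) * (\<Sum>\<rho>\<in>skeletons {m..<d}. weight \<beta> \<rho>)))"
        unfolding sum_rooted_skeletons_Suc
      proof (rule trans[OF sum_distrib_left sum.cong[OF refl]])
        fix m assume "m \<in> {Suc a..<d}"
        then have "c ^ (d - a) = c ^ (m - a) * c ^ (d - m)" by (simp flip: power_add)
        then show "c ^ (d - a) * ((\<Sum>(S, \<rho>)\<in>rooted_skeletons a m k. weight \<beta> \<rho>) *
             (\<Sum>\<rho>\<in>skeletons {m..<d}. weight \<beta> \<rho>)) =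
           c ^ (m - a) * (\<Sum>(S, \<rho>)\<in>rooted_skeletons a m k. weight \<beta> \<rho>) *
             (c ^ (d - m) * (\<Sum>\<rho>\<in>skeletons {m..<d}. weight \<beta> \<rho>))"
          by (simp only: mult_ac)
      qed
      also have "\<dots> = (\<Sum>m\<in>{Suc a..<d}. c * fps_nth ?A (m - a) * fps_nth M (d - m))"
      proof (intro sum.cong refl)
        fix m assume m: "m \<in> {Suc a..<d}"
        have "c ^ (d - m) * (\<Sum>\<rho>\<in>skeletons {m..<d}. weight \<beta> \<rho>) = fps_nth M (d - m)"
          using less.hyps[of d m] Suc.prems m by auto
        then show "c ^ (m - a) * (\<Sum>(S, \<rho>)\<in>rooted_skeletons a m k. weight \<beta> \<rho>) *
             (c ^ (d - m) * (\<Sum>\<rho>\<in>skeletons {m..<d}. weight \<beta> \<rho>)) =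
           c * fps_nth ?A (m - a) * fps_nth M (d - m)"
          using Suc.IH[of m] Suc.prems m by auto
      qed
      also have "\<dots> = (\<Sum>i\<in>{1..<d - a}. c * fps_nth ?A i * fps_nth M (d - a - i))"
        by (rule sum.reindex_bij_witness[where i = "\<lambda>i. i + a" and j = "\<lambda>m. m - a"]) auto
      \<comment> \<open>The two added end terms vanish: \<open>?A\<close> has the factor \<open>fps_X\<close>, and \<open>M\<close> has no constant term.\<close>
      also have "\<dots> = (\<Sum>i=0..d - a. c * fps_nth ?A i * fps_nth M (d - a - i))"
      proof (rule sum.mono_neutral_left)
        show "\<forall>i\<in>{0..d - a} - {1..<d - a}. c * fps_nth ?A i * fps_nth M (d - a - i) = 0"
        proof
          fix i assume "i \<in> {0..d - a} - {1..<d - a}"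
          then have "i = 0 \<or> i = d - a" by auto
          then show "c * fps_nth ?A i * fps_nth M (d - a - i) = 0"
            using M0 by (auto simp: mult.assoc)
        qed
      qed auto
      also have "\<dots> = c * fps_nth (?A * M) (d - a)"
        unfolding fps_mult_nth[of ?A M] sum_distrib_left by (simp only: mult.assoc)
      finally show ?case by (simp add: mult_ac)
    qed
    have "c ^ (b - a) * (\<Sum>\<rho>\<in>skeletons {a..<b}. weight \<beta> \<rho>) =
        (\<Sum>k<b - a. \<beta> k * (c ^ (b - a) * (\<Sum>(S, \<rho>)\<in>rooted_skeletons a b k. weight \<beta> \<rho>)))"
      unfolding sum_skeletons_eq_sum_rooted[OF ab, of \<beta>, OF \<beta>0]
      by (rule trans[OF sum_distrib_left sum.cong[OF refl]]) (rule mult.left_commute)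
    also have "\<dots> = (\<Sum>k<b - a. fps_nth T k * fps_nth (fps_X * (1 + M) * M ^ k) (b - a))"
      unfolding G[OF ab order_refl] using c(2) by (simp add: \<beta>_def)
    also have "\<dots> = fps_nth M (b - a)"
      using fps_mult_compose_nth[OF M0, of "1 + M" T "b - a"] M by simp
    finally show ?thesis using ab by simp
  qed
qed

theorem proposition8p1:
  fixes scale :: "complex \<Rightarrow> 'a::ring_1 \<Rightarrow> 'a"
    and phi :: "'a \<Rightarrow> complex"
    and a :: 'a
    and T :: "complex fps"
    and n :: nat
  assumes "nc_prob_space scale phi"
    and "phi a \<noteq> 0"
    and "T = T_transform (moment_gf phi a)"
    and "n \<ge> 1"
  shows "phi (a ^ n) =
    (\<Sum>\<pi>\<in>NCL n. fps_nth T 0 ^ (n - card \<pi>) * (\<Prod>S\<in>\<pi>. fps_nth T (card S - 1)))"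
proof -
  define F where "F = moment_gf phi a"
  define M where "M = fps_X * F"
  define c where "c = fps_nth T 0"
  define \<beta> where "\<beta> = (\<lambda>k. fps_nth T k / c)"
  have F0: "fps_nth F 0 \<noteq> 0" using assms(2) by (simp add: F_def moment_gf_def)
  then have c: "c \<noteq> 0" using assms(3) T_transform_nth_0 by (simp add: c_def F_def)
  have M: "M = fps_X * (1 + M) * (T oo M)"
    using T_transform_functional_equation[OF F0] assms(3) by (simp add: M_def F_def)
  have "(\<Sum>\<pi>\<in>NCL n. c ^ (n - card \<pi>) * (\<Prod>S\<in>\<pi>. fps_nth T (card S - 1))) =
      (\<Sum>\<pi>\<in>NCL n. c ^ n * weight \<beta> \<pi>)"
  proof (intro sum.cong refl)
    fix \<pi> assume "\<pi> \<in> NCL n"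
    then have "c ^ n = c ^ (n - card \<pi>) * c ^ card \<pi>"
      using card_NCL_le by (simp flip: power_add)
    then show "c ^ (n - card \<pi>) * (\<Prod>S\<in>\<pi>. fps_nth T (card S - 1)) = c ^ n * weight \<beta> \<pi>"
      using c by (simp add: weight_def \<beta>_def prod_dividef)
  qed
  also have "\<dots> = c ^ n * (\<Sum>\<rho>\<in>skeletons {1..n}. weight \<beta> \<rho>)"
    using sum_NCL_eq_sum_skeletons[of \<beta> n] c by (simp add: \<beta>_def c_def sum_distrib_left[symmetric])
  also have "\<dots> = fps_nth (1 + M) n"
    using sum_skeletons_eq_coeff[OF _ M c_def c, of 1 "Suc n"]
    by (simp add: M_def \<beta>_def atLeastLessThanSuc_atLeastAtMost)
  also have "\<dots> = phi (a ^ n)"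
    using assms(4) by (cases n) (simp_all add: M_def F_def moment_gf_def)
  finally show ?thesis by (simp add: c_def)
qed

end
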